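(* Let $\mathbb{K}$ be a field of characteristic zero. The triples $(\varphi,\psi,\rho)$ of formal series in $\mathbb{K}[[t]]$ satisfying $$\varphi(t)\,\frac{\psi(t+u)-\psi(u)}{t}+\frac{\varphi(t+u)-\varphi(t)}{u}\,\psi(u)=\rho(t+u)$$ in $\mathbb{K}[[t,u]]$ and $\psi(0)\varphi(0)\ne0$ are exactly those of the form $$\varphi(t)=a\theta_c(t)+bt,\qquad\psi(t)=d\theta_c(t)+et,\qquad\rho(t)=(ae+bd)\theta_c(t)+(adc+be)t$$ with $a,b,c,d,e\in\mathbb{K}$ and $ad\ne0$.
   Context: For $c\in\mathbb{K}$, $\theta_c(t)=\sqrt c\,t\coth(\sqrt c\,t)=1+\frac c3t^2-\frac{c^2}{45}t^4+\cdots\in\mathbb{K}[[t]]$, i.e. $\theta_c$ is the power series obtained from $z\coth z=\sum_{k\ge0}\frac{2^{2k}B_{2k}}{(2k)!}z^{2k}$ ($B_{2k}$ the Bernoulli numbers) by replacing $z^2$ by $ct^2$ (no square root of $c$ in $\mathbb{K}$ is needed); in particular $\theta_0=1$. *)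

theory Defs
  imports "HOL-Computational_Algebra.Computational_Algebra"
begin

text \<open>
  \<open>\<bbbK>[[t,u]]\<close> is represented as \<open>\<bbbK>[[u]][[t]]\<close>, i.e. by the type \<open>'a fps fps\<close>: the
  coefficient of \<open>t\<^sup>i u\<^sup>j\<close> in \<open>F\<close> is \<open>F $ i $ j\<close>.
\<close>

abbreviation var_t :: "'a::comm_ring_1 fps fps" where
  "var_t \<equiv> fps_X"

abbreviation var_u :: "'a::comm_ring_1 fps fps" where
  "var_u \<equiv> fps_const fps_X"

text \<open>
  Substitution of a bivariate series \<open>G\<close> without constant term into a univariate series \<open>f\<close>,
  i.e. the sum of all \<open>f $ n * G ^ n\<close>.  As \<open>G ^ n\<close> has no terms of total degree below \<open>n\<close>, only
  the exponents \<open>n \<le> i + j\<close> contribute to the coefficient of \<open>t\<^sup>i u\<^sup>j\<close>.  The library's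
  \<open>fps_compose\<close> does not apply to \<open>G = t + u\<close>, because the constant coefficient of \<open>t + u\<close> with
  respect to \<open>t\<close> is \<open>u\<close>, not \<open>0\<close>.
\<close>

definition fps2_subst :: "'a::comm_ring_1 fps \<Rightarrow> 'a fps fps \<Rightarrow> 'a fps fps" where
  "fps2_subst f G = Abs_fps (\<lambda>i. Abs_fps (\<lambda>j. \<Sum>n\<le>i + j. f $ n * (G ^ n) $ i $ j))"

text \<open>
  The exact quotient in the integral domain \<open>\<bbbK>[[t,u]]\<close>; it is only meaningful if the division
  is possible.  The library's division on \<open>'a fps fps\<close> is of no use for \<open>F / u\<close>, since it
  multiplies by the (junk) inverse of the non-unit \<open>u\<close> of \<open>\<bbbK>[[u]]\<close>.
\<close>

definition fps2_quot :: "'a::idom fps fps \<Rightarrow> 'a fps fps \<Rightarrow> 'a fps fps" where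
  "fps2_quot F G = (THE Q. Q * G = F)"

text \<open>Bernoulli numbers, by their exponential generating function \<open>z / (exp z - 1)\<close>.\<close>

definition bernoulli :: "nat \<Rightarrow> rat" where
  "bernoulli n = fact n * (fps_X / (fps_exp 1 - 1)) $ n"

definition theta :: "'a::field_char_0 \<Rightarrow> 'a fps" where
  "theta c = Abs_fps (\<lambda>n. if even n
     then of_rat (2 ^ n * bernoulli n / fact n) * c ^ (n div 2) else 0)"

subsection \<open>Adequacy of the definitions\<close>

lemma var_sum_power_nth:
  "((var_t + var_u) ^ n :: 'a::comm_ring_1 fps fps) $ i $ j =
     (if i + j = n then of_nat (n choose i) else 0)"
proof -
  have "((var_t + var_u) ^ n :: 'a fps fps) =
      (\<Sum>k\<le>n. of_nat (n choose k) * fps_X ^ k * fps_const fps_X ^ (n - k))"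
    by (rule binomial_ring)
  also have "\<dots> = (\<Sum>k\<le>n. fps_const (of_nat (n choose k) * fps_X ^ (n - k)) * fps_X ^ k)"
    by (simp add: fps_const_power fps_of_nat [symmetric] mult_ac flip: fps_const_mult)
  finally have "((var_t + var_u) ^ n :: 'a fps fps) $ i $ j =
      (\<Sum>k\<le>n. if k = i then (of_nat (n choose k) * fps_X ^ (n - k)) $ j else 0)"
    by (simp only: fps_sum_nth fps_mult_left_const_nth fps_X_power_nth)
       (intro sum.cong refl, simp)
  also have "\<dots> = (if i \<le> n then (of_nat (n choose i) * fps_X ^ (n - i)) $ j else 0)"
    by simp
  also have "\<dots> = (if i + j = n then of_nat (n choose i) else 0)"
    by (auto simp: fps_of_nat [symmetric] fps_X_power_nth)
  finally show ?thesis .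
qed

lemma fps2_subst_add_nth:
  "fps2_subst f (var_t + var_u) $ i $ j = of_nat ((i + j) choose i) * f $ (i + j)"
  by (simp add: fps2_subst_def var_sum_power_nth mult.commute if_distrib cong: if_cong)

lemma fps2_subst_t_nth: "fps2_subst f var_t $ i $ j = (if j = 0 then f $ i else 0)"
proof -
  have "fps2_subst f var_t $ i $ j = (\<Sum>n\<le>i + j. if n = i then (if j = 0 then f $ i else 0) else 0)"
    unfolding fps2_subst_def fps_nth_Abs_fps by (intro sum.cong) (auto simp: fps_X_power_nth)
  then show ?thesis by simp
qed

lemma fps2_subst_u_nth: "fps2_subst f var_u $ i $ j = (if i = 0 then f $ j else 0)"
proof -
  have "fps2_subst f var_u $ i $ j = (\<Sum>n\<le>i + j. if n = j then (if i = 0 then f $ j else 0) else 0)"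
    unfolding fps2_subst_def fps_nth_Abs_fps
    by (intro sum.cong) (auto simp: fps_const_power fps_X_power_nth)
  then show ?thesis by simp
qed

lemma fps2_quot_eqI: "Q * G = F \<Longrightarrow> G \<noteq> 0 \<Longrightarrow> fps2_quot F G = Q"
  unfolding fps2_quot_def by (rule the_equality) auto

lemma fps2_quot_t_mult:
  fixes f :: "'a::idom fps"
  shows "fps2_quot (fps2_subst f (var_t + var_u) - fps2_subst f var_u) var_t * var_t =
           fps2_subst f (var_t + var_u) - fps2_subst f var_u" (is "fps2_quot ?F _ * _ = _")
proof -
  have eq: "fps_shift 1 ?F * var_t = ?F"
    by (intro fps_ext) (auto simp: fps2_subst_add_nth fps2_subst_u_nth)
  have "fps2_quot ?F var_t = fps_shift 1 ?F"
    by (rule fps2_quot_eqI [OF eq]) simp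
  with eq show ?thesis by simp
qed

lemma fps2_quot_u_mult:
  fixes f :: "'a::idom fps"
  shows "fps2_quot (fps2_subst f (var_t + var_u) - fps2_subst f var_t) var_u * var_u =
           fps2_subst f (var_t + var_u) - fps2_subst f var_t" (is "fps2_quot ?F _ * _ = _")
proof -
  let ?Q = "Abs_fps (\<lambda>i. fps_shift 1 (?F $ i))"
  have eq: "?Q * var_u = ?F"
    by (intro fps_ext) (auto simp: fps2_subst_add_nth fps2_subst_t_nth)
  have "fps2_quot ?F var_u = ?Q"
    by (rule fps2_quot_eqI [OF eq]) simp
  with eq show ?thesis by simp
qed

lemma bernoulli_fps: "fps_X / (fps_exp 1 - 1) * (fps_exp 1 - 1) = (fps_X :: rat fps)"
proof -
  have "subdegree (fps_exp 1 - 1 :: rat fps) = 1"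
    by (rule subdegreeI) auto
  then show ?thesis
    by (intro fps_times_divide_eq) (auto simp: fps_eq_iff intro!: exI [of _ 1])
qed

lemma theta_0: "theta 0 = 1"
proof (rule fps_ext)
  fix n :: nat
  have "(fps_X / (fps_exp 1 - 1) * (fps_exp 1 - 1)) $ 1 = (1 :: rat)"
    by (simp only: bernoulli_fps) simp
  then have "(fps_X / (fps_exp 1 - 1)) $ 0 = (1 :: rat)"
    by (simp add: fps_mult_nth)
  then show "theta 0 $ n = (1 :: 'a fps) $ n"
    by (auto simp: theta_def bernoulli_def elim!: evenE)
qed

text \<open>
  \<open>theta 1\<close> is \<open>z coth z\<close>, as \<open>coth z = (exp z + exp (- z)) / (exp z - exp (- z))\<close>; for general
  \<open>c\<close>, the coefficients are those of \<open>theta 1\<close> with \<open>z\<^sup>2\<close> replaced by \<open>c t\<^sup>2\<close>.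
\<close>

lemma theta_nth: "theta c $ n = theta 1 $ n * c ^ (n div 2)"
  by (simp add: theta_def)

lemma theta_1_eq_z_coth_z:
  "theta 1 * (fps_exp 1 - fps_exp (- 1)) = fps_X * (fps_exp 1 + fps_exp (- 1 :: 'a::field_char_0))"
proof -
  define b where "b = (fps_X / (fps_exp 1 - 1) :: rat fps)"
  have b: "b * (fps_exp 1 - 1) = fps_X"
    unfolding b_def by (rule bernoulli_fps)
  define B where "B = Abs_fps (\<lambda>n. of_rat (b $ n) :: 'a)"
  have B: "B * (fps_exp 1 - 1) = fps_X"
  proof (rule fps_ext)
    fix n
    have "of_rat (fact m) = (fact m :: 'a)" for m
      by (metis of_nat_fact of_rat_of_nat_eq)
    then have "(B * (fps_exp 1 - 1)) $ n = of_rat ((b * (fps_exp 1 - 1)) $ n)"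
      by (simp add: fps_mult_nth B_def of_rat_sum of_rat_mult of_rat_diff of_rat_divide
          if_distrib [of of_rat] cong: if_cong)
    then show "(B * (fps_exp 1 - 1)) $ n = (fps_X :: 'a fps) $ n"
      by (simp add: b)
  qed
  define H where "H = (B oo (fps_const 2 * fps_X)) + fps_X"
  have "(B * (fps_exp 1 - 1)) oo (fps_const 2 * fps_X) = fps_X oo (fps_const 2 * fps_X)"
    by (simp only: B)
  then have *: "(B oo (fps_const 2 * fps_X)) * (fps_exp 2 - 1) = fps_const 2 * fps_X"
    by (simp add: fps_compose_mult_distrib fps_compose_sub_distrib)
  have exps: "fps_exp 2 = fps_exp 1 * (fps_exp 1 :: 'a fps)" "fps_exp 1 * fps_exp (- 1) = (1 :: 'a fps)"
    by (simp_all flip: fps_exp_add_mult)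
  have "fps_exp 1 * (H * (fps_exp 1 - fps_exp (- 1))) = H * (fps_exp 2 - 1)"
    using exps by algebra
  also have "\<dots> = fps_const 2 * fps_X + fps_X * (fps_exp 2 - 1)"
    using * by (simp add: H_def algebra_simps)
  also have "\<dots> = fps_X * (fps_exp 2 + 1)"
    by (simp add: algebra_simps flip: numeral_fps_const)
  also have "\<dots> = fps_exp 1 * (fps_X * (fps_exp 1 + fps_exp (- 1)))"
    using exps by algebra
  finally have H: "H * (fps_exp 1 - fps_exp (- 1)) = fps_X * (fps_exp 1 + fps_exp (- 1))"
    by simp
  define H' where "H' = H oo (fps_const (- 1) * fps_X)"
  have "(H * (fps_exp 1 - fps_exp (- 1))) oo (fps_const (- 1) * fps_X) =
        (fps_X * (fps_exp 1 + fps_exp (- 1))) oo (fps_const (- 1) * fps_X)"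
    by (simp only: H)
  then have "H' * (fps_exp (- 1) - fps_exp 1) = fps_const (- 1) * fps_X * (fps_exp (- 1) + fps_exp 1)"
    unfolding fps_compose_mult_distrib [of "fps_const (- 1) * fps_X", simplified]
    by (simp add: H'_def fps_compose_mult_distrib fps_compose_sub_distrib fps_compose_add_distrib del: fps_const_neg)
  then have "H' * (fps_exp 1 - fps_exp (- 1)) = H * (fps_exp 1 - fps_exp (- 1))"
    unfolding H by (simp add: algebra_simps flip: fps_const_neg)
  then have "H' = H" by simp
  have odd: "H $ n = 0" if "odd n" for n
  proof -
    have "H $ n = H' $ n" by (simp add: \<open>H' = H\<close>)
    also have "\<dots> = - H $ n" using that by (simp add: H'_def fps_compose_linear del: fps_const_neg)
    finally show ?thesis by simp
  qed
  have "theta 1 = H"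
  proof (rule fps_ext)
    fix n show "theta 1 $ n = H $ n"
    proof (cases "even n")
      case True
      then have "n \<noteq> 1" by auto
      with True show ?thesis
        by (simp add: theta_def H_def B_def b_def bernoulli_def fps_compose_linear of_rat_mult of_rat_power)
    qed (simp add: odd theta_def)
  qed
  with H show ?thesis by simp
qed

end

theory Submission
  imports Defs
begin

text \<open>
  After multiplication by \<open>t u\<close>, the equation is symmetric in \<open>(\<phi>, t)\<close> and \<open>(\<psi>, u)\<close>.  Comparing
  the terms of order one in \<open>t\<close> and in \<open>u\<close> shows that \<open>h = \<psi>(0) \<phi> - \<phi>(0) \<psi>\<close> satisfies
  \<open>t h' = h\<close>, so \<open>h\<close> is a multiple of \<open>t\<close>.  As the equation is compatible with adding multiples of
  \<open>t\<close> to \<open>\<phi>\<close> and \<open>\<psi>\<close>, this reduces it to \<open>\<phi> = \<psi> = F\<close> with \<open>F = 1 + O(t\<^sup>2)\<close> and right-hand side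
  \<open>R\<close>.  Then order one gives \<open>t F' + F\<^sup>2 - F = t R\<close> and order two gives
  \<open>t F'' + 2 F F' = 2 t R'\<close>; differentiating the former yields \<open>t R' = R\<close>, hence \<open>R = c t\<close>, and
  \<open>F\<close> is the unique solution \<open>\<theta>\<^sub>c\<close> of a Riccati equation.  Conversely, \<open>\<theta>\<^sub>c\<close> solves the equation by
  the addition formulas of \<open>sinh\<close> and \<open>cosh\<close>.
\<close>

section \<open>Substituting t, u and t + u as ring homomorphisms\<close>

lemma fps2_subst_t_nth': "fps2_subst f var_t $ i = fps_const (f $ i)"
  by (rule fps_ext) (simp add: fps2_subst_t_nth)

lemma fps2_subst_u: "fps2_subst f var_u = fps_const f"
  by (intro fps_ext) (simp add: fps2_subst_u_nth)

lemma fps2_subst_t_mult: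
  "fps2_subst (f * g) var_t = fps2_subst f var_t * fps2_subst g var_t"
proof (rule fps_ext)
  fix i
  show "fps2_subst (f * g) var_t $ i = (fps2_subst f var_t * fps2_subst g var_t) $ i"
    by (rule fps_ext)
      (auto simp: fps_mult_nth fps2_subst_t_nth' fps_sum_nth if_distrib cong: if_cong)
qed

lemma fps2_subst_u_mult:
  "fps2_subst (f * g) var_u = fps2_subst f var_u * fps2_subst g var_u"
  by (simp add: fps2_subst_u)

lemma fps2_subst_plus: "fps2_subst (f + g) G = fps2_subst f G + fps2_subst g G"
  by (intro fps_ext) (simp add: fps2_subst_def algebra_simps sum.distrib)

lemma fps2_subst_const: "fps2_subst (fps_const a) G = fps_const (fps_const a)"
proof (intro fps_ext)
  fix i j
  have "fps2_subst (fps_const a) G $ i $ j =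
      (\<Sum>n\<le>i + j. if n = 0 then a * (1 :: 'a fps fps) $ i $ j else 0)"
    unfolding fps2_subst_def fps_nth_Abs_fps by (intro sum.cong) auto
  then show "fps2_subst (fps_const a) G $ i $ j = fps_const (fps_const a) $ i $ j"
    by simp
qed

lemma fps2_subst_t_X: "fps2_subst fps_X var_t = var_t"
  by (intro fps_ext) (simp add: fps2_subst_t_nth)

lemma fps2_subst_add_X: "fps2_subst fps_X (var_t + var_u) = var_t + var_u"
  by (intro fps_ext) (auto simp: fps2_subst_add_nth)

lemma fps2_subst_add_nth_0: "fps2_subst f (var_t + var_u) $ 0 = f"
  by (rule fps_ext) (simp add: fps2_subst_add_nth)

text \<open>On coefficients this is the absorption identity for binomials; conceptually, f(t + u)
  has equal partial derivatives in t and u.\<close>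

lemma fps2_subst_add_nth_Suc:
  "of_nat (Suc i) * fps2_subst f (var_t + var_u) $ Suc i = fps_deriv (fps2_subst f (var_t + var_u) $ i)"
proof (rule fps_ext)
  fix j
  have "Suc i * (Suc i + j choose Suc i) = Suc j * (i + Suc j choose i)"
    using Suc_times_binomial_add [of i j] by (simp add: add.commute)
  from this [THEN arg_cong [where f = "of_nat :: nat \<Rightarrow> 'a"]]
  have "of_nat (Suc i) * (of_nat (Suc i + j choose Suc i) * f $ (Suc i + j)) =
      of_nat (Suc j) * (of_nat (i + Suc j choose i) * f $ (Suc i + j))"
    by (simp only: of_nat_mult mult.assoc [symmetric])
  then show "(of_nat (Suc i) * fps2_subst f (var_t + var_u) $ Suc i) $ j =
      fps_deriv (fps2_subst f (var_t + var_u) $ i) $ j"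
    by (simp add: fps2_subst_add_nth fps_of_nat [symmetric] del: of_nat_Suc)
qed

text \<open>The first two assumptions are the transport equation \<open>\<partial>\<^sub>t F = \<partial>\<^sub>u F\<close>, which \<open>f(t + u)\<close> satisfies.\<close>

lemma fps2_transport_unique:
  fixes F G :: "'a::field_char_0 fps fps"
  assumes "\<And>i. of_nat (Suc i) * F $ Suc i = fps_deriv (F $ i)"
    and "\<And>i. of_nat (Suc i) * G $ Suc i = fps_deriv (G $ i)"
    and "F $ 0 = G $ 0"
  shows "F = G"
proof (rule fps_ext)
  fix i
  show "F $ i = G $ i"
  proof (induction i)
    case (Suc i)
    then have "of_nat (Suc i) * F $ Suc i = of_nat (Suc i) * G $ Suc i"
      by (simp only: assms)
    moreover have "of_nat (Suc i) \<noteq> (0 :: 'a fps)"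
      by (simp add: fps_of_nat [symmetric] del: of_nat_Suc)
    ultimately show ?case by simp
  qed (fact assms)
qed

text \<open>The partial derivatives in t and u are derivations, hence so is their difference, and
  the kernel of a derivation is closed under products.\<close>

lemma fps2_transport_mult:
  fixes F G :: "'a::comm_ring_1 fps fps"
  assumes F: "\<And>i. of_nat (Suc i) * F $ Suc i = fps_deriv (F $ i)"
    and G: "\<And>i. of_nat (Suc i) * G $ Suc i = fps_deriv (G $ i)"
  shows "of_nat (Suc i) * (F * G) $ Suc i = fps_deriv ((F * G) $ i)"
proof -
  \<comment> \<open>The outer \<open>fps_deriv\<close> differentiates in t, the inner one in
    u.\<close>
  have "fps_deriv F $ k = fps_deriv (F $ k)" "fps_deriv G $ k = fps_deriv (G $ k)" for k
    using F [of k] G [of k] by simp_all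
  then have "fps_deriv ((F * G) $ i) = (F * fps_deriv G + fps_deriv F * G) $ i"
    by (simp add: fps_mult_nth fps_deriv_sum sum.distrib del: fps_deriv_nth)
  then show ?thesis by (simp flip: fps_deriv_mult)
qed

text \<open>Both sides solve the transport equation and reduce to \<open>f * g\<close> at t = 0;
  uniqueness replaces a Vandermonde convolution.\<close>

lemma fps2_subst_add_mult:
  fixes f g :: "'a::field_char_0 fps"
  shows "fps2_subst (f * g) (var_t + var_u) =
    fps2_subst f (var_t + var_u) * fps2_subst g (var_t + var_u)"
  by (rule fps2_transport_unique fps2_transport_mult fps2_subst_add_nth_Suc)+
    (simp add: fps2_subst_add_nth_0)

lemmas fps2_subst_simps =
  fps2_subst_plus fps2_subst_t_mult fps2_subst_u_mult fps2_subst_add_mult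
  fps2_subst_const fps2_subst_t_X fps2_subst_add_X

section \<open>Exchanging t and u\<close>

definition fps2_swap :: "'a fps fps \<Rightarrow> 'a fps fps" where
  "fps2_swap F = Abs_fps (\<lambda>i. Abs_fps (\<lambda>j. F $ j $ i))"

lemma fps2_swap_nth [simp]: "fps2_swap F $ i $ j = F $ j $ i"
  by (simp add: fps2_swap_def)

lemma fps2_swap_plus: "fps2_swap (F + G) = fps2_swap F + fps2_swap G"
  by (intro fps_ext) simp

lemma fps2_swap_mult:
  fixes F G :: "'a::comm_ring_1 fps fps"
  shows "fps2_swap (F * G) = fps2_swap F * fps2_swap G"
proof (intro fps_ext)
  fix i j
  show "fps2_swap (F * G) $ i $ j = (fps2_swap F * fps2_swap G) $ i $ j"
    by (simp add: fps_mult_nth fps_sum_nth) (rule sum.swap)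
qed

lemma fps2_swap_subst:
  "fps2_swap (fps2_subst f var_t) = fps2_subst f var_u"
  "fps2_swap (fps2_subst f var_u) = fps2_subst f var_t"
  "fps2_swap (fps2_subst f (var_t + var_u)) = fps2_subst f (var_t + var_u)"
proof -
  show "fps2_swap (fps2_subst f (var_t + var_u)) = fps2_subst f (var_t + var_u)"
  proof (intro fps_ext)
    fix i j
    have "(i + j choose j) = (i + j choose i)"
      using binomial_symmetric [of i "i + j"] by simp
    then show "fps2_swap (fps2_subst f (var_t + var_u)) $ i $ j = fps2_subst f (var_t + var_u) $ i $ j"
      by (simp add: fps2_subst_add_nth add.commute [of j i])
  qed
qed (intro fps_ext; simp add: fps2_subst_t_nth fps2_subst_u_nth)+

lemma fps2_swap_vars: "fps2_swap var_t = var_u" "fps2_swap var_u = var_t"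
  using fps2_swap_subst(1,2) [of fps_X] by (simp_all add: fps2_subst_t_X fps2_subst_u)

section \<open>The equation cleared of quotients\<close>

text \<open>The equation multiplied by \<open>t u\<close>, with the negative terms moved to the right.\<close>

definition func_eq :: "'a::comm_ring_1 fps \<Rightarrow> 'a fps \<Rightarrow> 'a fps \<Rightarrow> bool" where
  "func_eq \<phi> \<psi> \<rho> \<longleftrightarrow>
     var_u * fps2_subst \<phi> var_t * fps2_subst \<psi> (var_t + var_u) +
     var_t * fps2_subst \<phi> (var_t + var_u) * fps2_subst \<psi> var_u =
     (var_t + var_u) * fps2_subst \<phi> var_t * fps2_subst \<psi> var_u +
     var_t * var_u * fps2_subst \<rho> (var_t + var_u)"

text \<open>The factor \<open>var_t * var_u\<close> can be cancelled in an integral domain, and each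
  quotient times its denominator returns its numerator.\<close>

lemma func_eq_iff_quot:
  fixes \<phi> \<psi> \<rho> :: "'a::idom fps"
  shows "fps2_subst \<phi> var_t
      * fps2_quot (fps2_subst \<psi> (var_t + var_u) - fps2_subst \<psi> var_u) var_t
    + fps2_quot (fps2_subst \<phi> (var_t + var_u) - fps2_subst \<phi> var_t) var_u
      * fps2_subst \<psi> var_u
    = fps2_subst \<rho> (var_t + var_u) \<longleftrightarrow> func_eq \<phi> \<psi> \<rho>"
    (is "?A * ?q + ?q' * ?B = ?C \<longleftrightarrow> _")
proof -
  have nz: "(var_t * var_u :: 'a fps fps) \<noteq> 0"
    by simp
  have "?A * ?q + ?q' * ?B = ?C \<longleftrightarrow>
      var_t * var_u * (?A * ?q + ?q' * ?B) = var_t * var_u * ?C"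
    using nz by (simp only: mult_cancel_left) simp
  also have "var_t * var_u * (?A * ?q + ?q' * ?B) =
      var_u * ?A * (?q * var_t) + var_t * (?q' * var_u) * ?B"
    by (simp only: algebra_simps)
  also have "\<dots> = var_u * ?A * fps2_subst \<psi> (var_t + var_u) + var_t * fps2_subst \<phi> (var_t + var_u) * ?B
      - (var_t + var_u) * ?A * ?B"
    unfolding fps2_quot_t_mult fps2_quot_u_mult by (simp only: algebra_simps)
  finally show ?thesis
    unfolding func_eq_def diff_eq_eq by (simp only: add.commute)
qed

lemma func_eq_commute:
  assumes "func_eq \<phi> \<psi> \<rho>"
  shows "func_eq \<psi> \<phi> \<rho>"
  using assms [unfolded func_eq_def, THEN arg_cong [where f = fps2_swap]]
  unfolding func_eq_def fps2_swap_plus fps2_swap_mult fps2_swap_subst fps2_swap_vars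
  by (simp only: algebra_simps)

text \<open>Passing from F and R to the affine combinations multiplies the difference of the two
  sides by \<open>a * d\<close>; the third argument absorbs all terms containing b or e.\<close>

lemma func_eq_affine_iff:
  fixes F R :: "'a::field_char_0 fps"
  assumes "a * d \<noteq> 0"
  shows "func_eq (fps_const a * F + fps_const b * fps_X) (fps_const d * F + fps_const e * fps_X)
      (fps_const (a * e + b * d) * F + fps_const (b * e) * fps_X + fps_const (a * d) * R)
    \<longleftrightarrow> func_eq F F R"
proof -
  let ?k = "\<lambda>x. fps_const (fps_const x) :: 'a fps fps"
  \<comment> \<open>P, Q, T stand for F at t, u, t + u, and S for R at t + u.\<close>
  have ring: "(u * (A * P + B * t) * (D * T + E * (t + u)) +
      t * (A * T + B * (t + u)) * (D * Q + E * u) =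
      (t + u) * (A * P + B * t) * (D * Q + E * u) +
      t * u * ((A * E + B * D) * T + B * E * (t + u) + A * D * S)) \<longleftrightarrow>
      A * D * (u * P * T + t * T * Q) = A * D * ((t + u) * P * Q + t * u * S)"
    (is "?l = ?r \<longleftrightarrow> ?l' = ?r'") for A B D E P Q S T t u :: "'a fps fps"
  proof -
    have "?l - ?r = ?l' - ?r'" by algebra
    then show ?thesis by (metis eq_iff_diff_eq_0)
  qed
  have "?k a * ?k d \<noteq> 0"
    using assms by simp
  moreover have k: "?k (a * e + b * d) = ?k a * ?k e + ?k b * ?k d" "?k (b * e) = ?k b * ?k e"
      "?k (a * d) = ?k a * ?k d"
    by simp_all
  moreover have "fps2_subst fps_X var_u = (var_u :: 'a fps fps)"
    by (simp add: fps2_subst_u)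
  ultimately show ?thesis
    unfolding func_eq_def fps2_subst_simps k by (simp only: ring mult_cancel_left mult_eq_0_iff) blast
qed

section \<open>Coefficients of t and of t^2\<close>

text \<open>Comparing the coefficients of t leaves series in u, now written \<open>fps_X\<close>;
  the two terms with \<open>\<phi> $ 1\<close> cancel.\<close>

lemma func_eq_nth_1:
  assumes "func_eq \<phi> \<psi> \<rho>"
  shows "fps_X * fps_const (\<phi> $ 0) * fps_deriv \<psi> + (\<phi> - fps_const (\<phi> $ 0)) * \<psi> = fps_X * \<rho>"
proof -
  have T: "fps2_subst f (var_t + var_u) $ Suc 0 = fps_deriv f" for f :: "'a fps"
    using fps2_subst_add_nth_Suc [of 0 f] by (simp add: fps2_subst_add_nth_0)
  show ?thesis
    using assms [unfolded func_eq_def, THEN arg_cong [where f = "\<lambda>F. F $ 1"]]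
    by (simp add: fps2_subst_u fps_mult_nth fps2_subst_t_nth' fps2_subst_add_nth_0 T algebra_simps)
qed

text \<open>In the coefficient of t^2 the terms with \<open>F $ 2\<close> cancel, and those with
  \<open>F $ 1\<close> vanish.\<close>

lemma func_eq_nth_2:
  assumes "func_eq F F R" "F $ 0 = 1" "F $ 1 = 0"
  shows "fps_X * fps_deriv (fps_deriv F) + 2 * F * fps_deriv F = 2 * fps_X * fps_deriv R"
proof -
  have T1: "fps2_subst f (var_t + var_u) $ Suc 0 = fps_deriv f" for f :: "'a fps"
    using fps2_subst_add_nth_Suc [of 0 f] by (simp add: fps2_subst_add_nth_0)
  have T2: "2 * fps2_subst f (var_t + var_u) $ Suc (Suc 0) = fps_deriv (fps_deriv f)" for f :: "'a fps"
    using fps2_subst_add_nth_Suc [of 1 f] by (simp add: T1)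
  have "fps_X * fps2_subst F (var_t + var_u) $ Suc (Suc 0) + F * fps_deriv F = fps_X * fps_deriv R"
    using assms(2,3) assms(1) [unfolded func_eq_def, THEN arg_cong [where f = "\<lambda>F. F $ 2"]]
    by (simp add: fps2_subst_u fps_mult_nth fps2_subst_t_nth' fps2_subst_add_nth_0 T1
        numeral_2_eq_2 algebra_simps)
  \<comment> \<open>The t^2 coefficient of F(t + u) is F''/2, so doubling makes \<open>T2\<close>
    applicable.\<close>
  then have "2 * (fps_X * fps2_subst F (var_t + var_u) $ Suc (Suc 0) + F * fps_deriv F) =
      2 * (fps_X * fps_deriv R)"
    by (simp only:)
  then show ?thesis
    unfolding T2 [symmetric] by (simp only: algebra_simps)
qed

text \<open>Coefficientwise n f_n = f_n, so in characteristic zero only n = 1 survives.\<close>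

lemma fps_X_deriv_eq_self:
  fixes f :: "'a::field_char_0 fps"
  assumes "fps_X * fps_deriv f = f"
  shows "f = fps_const (f $ 1) * fps_X"
proof (rule fps_ext)
  fix n
  show "f $ n = (fps_const (f $ 1) * fps_X) $ n"
  proof (cases n)
    case 0
    then show ?thesis
      using arg_cong [OF assms, of "\<lambda>f. f $ 0"] by simp
  next
    case (Suc m)
    then have "of_nat (Suc m) * f $ n = f $ n"
      using arg_cong [OF assms, of "\<lambda>f. f $ n"] by simp
    with Suc show ?thesis
      by (cases "m = 0") (auto simp: algebra_simps)
  qed
qed

section \<open>Hyperbolic functions and the equation for \<open>theta\<close>\<close>

text \<open>
  \<open>sinh (\<surd>c t) / \<surd>c\<close> and \<open>cosh (\<surd>c t)\<close>, whose coefficients do not involve \<open>\<surd>c\<close>.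
\<close>

definition fps_S :: "'a::field_char_0 \<Rightarrow> 'a fps" where
  "fps_S c = Abs_fps (\<lambda>n. if odd n then c ^ (n div 2) / fact n else 0)"

definition fps_C :: "'a::field_char_0 \<Rightarrow> 'a fps" where
  "fps_C c = Abs_fps (\<lambda>n. if even n then c ^ (n div 2) / fact n else 0)"

text \<open>Since binomial(i+j, i) / (i+j)! = 1 / (i! j!), the coefficients factor; the parities of
  i and j select the summand that contributes.\<close>

lemma fps_S_add:
  "fps2_subst (fps_S c) (var_t + var_u) =
     fps2_subst (fps_S c) var_t * fps2_subst (fps_C c) var_u +
     fps2_subst (fps_C c) var_t * fps2_subst (fps_S c) var_u"
proof (intro fps_ext)
  fix i j
  show "fps2_subst (fps_S c) (var_t + var_u) $ i $ j =
     (fps2_subst (fps_S c) var_t * fps2_subst (fps_C c) var_u +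
     fps2_subst (fps_C c) var_t * fps2_subst (fps_S c) var_u) $ i $ j"
    by (auto simp: fps2_subst_add_nth fps2_subst_t_nth' fps2_subst_u fps_S_def fps_C_def
        binomial_fact power_add elim!: evenE oddE)
qed

text \<open>For odd i and j, \<open>(i + j) div 2\<close> exceeds \<open>i div 2 + j div 2\<close>
  by one, whence the factor c.\<close>

lemma fps_C_add:
  "fps2_subst (fps_C c) (var_t + var_u) =
     fps2_subst (fps_C c) var_t * fps2_subst (fps_C c) var_u +
     fps_const (fps_const c) * fps2_subst (fps_S c) var_t * fps2_subst (fps_S c) var_u"
proof (intro fps_ext)
  fix i j
  show "fps2_subst (fps_C c) (var_t + var_u) $ i $ j =
     (fps2_subst (fps_C c) var_t * fps2_subst (fps_C c) var_u +
     fps_const (fps_const c) * fps2_subst (fps_S c) var_t * fps2_subst (fps_S c) var_u) $ i $ j"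
    by (auto simp: fps2_subst_add_nth fps2_subst_t_nth' fps2_subst_u fps_S_def fps_C_def
        binomial_fact power_add elim!: evenE oddE)
qed

text \<open>For c = 1 this is z coth z sinh z = z cosh z; the general case follows by weighting the
  n-th coefficient with \<open>c ^ (n div 2)\<close>.\<close>

lemma theta_times_S: "theta c * fps_S c = fps_X * fps_C (c :: 'a::field_char_0)"
proof -
  have S1: "fps_exp 1 - fps_exp (- 1) = fps_const 2 * (fps_S 1 :: 'a fps)"
    and C1: "fps_exp 1 + fps_exp (- 1) = fps_const 2 * (fps_C 1 :: 'a fps)"
    by (rule fps_ext; simp add: fps_S_def fps_C_def)+
  have "fps_const 2 * (theta 1 * fps_S 1) = fps_const 2 * (fps_X * fps_C (1 :: 'a))"
    using theta_1_eq_z_coth_z [where 'a = 'a] unfolding S1 C1 by (simp only: mult.left_commute)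
  then have one: "theta 1 * fps_S 1 = fps_X * fps_C (1 :: 'a)"
    by simp
  have S: "fps_S c $ n = fps_S 1 $ n * c ^ (n div 2)" for n
    by (simp add: fps_S_def)
  show ?thesis
  proof (rule fps_ext)
    fix n
    have "theta c $ k * fps_S c $ (n - k) = theta 1 $ k * fps_S 1 $ (n - k) * c ^ (n div 2)"
      if "k \<le> n" for k
    \<comment> \<open>Only even k with odd n - k contribute, and for these the halves add up without
      rounding loss.\<close>
    proof (cases "even k \<and> odd (n - k)")
      case True
      with that have "k div 2 + (n - k) div 2 = n div 2"
        by presburger
      then show ?thesis
        by (simp add: theta_nth [of c k] S [of "n - k"] flip: power_add)
    qed (auto simp: theta_def fps_S_def)
    then have "(theta c * fps_S c) $ n = (theta 1 * fps_S 1) $ n * c ^ (n div 2)"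
      by (simp add: fps_mult_nth sum_distrib_right)
    also have "\<dots> = (fps_X * fps_C c) $ n"
      unfolding one by (cases n) (auto simp: fps_C_def)
    finally show "(theta c * fps_S c) $ n = (fps_X * fps_C c) $ n" .
  qed
qed

lemma theta_nth_0 [simp]: "theta c $ 0 = 1"
  \<comment> \<open>With \<open>0 ^ 0 = 1\<close>, the case c = 0 yields
    \<open>theta 1 $ 0 = 1\<close>, and the constant term does not depend on c.\<close>
  by (subst theta_nth) (use theta_nth [of 0 0] in \<open>simp add: theta_0\<close>)

text \<open>Multiplying by the nonzero product S(t) S(u) S(t+u) turns every theta into its argument
  times C, so that the addition formulas apply.\<close>

lemma func_eq_theta:
  fixes c :: "'a::field_char_0"
  shows "func_eq (theta c) (theta c) (fps_const c * fps_X)"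
proof -
  define St Su Sv where "St = fps2_subst (fps_S c) var_t"
    and "Su = fps2_subst (fps_S c) var_u" and "Sv = fps2_subst (fps_S c) (var_t + var_u)"
  define Ct Cu Cv where "Ct = fps2_subst (fps_C c) var_t"
    and "Cu = fps2_subst (fps_C c) var_u" and "Cv = fps2_subst (fps_C c) (var_t + var_u)"
  define \<theta>t \<theta>u \<theta>v where "\<theta>t = fps2_subst (theta c) var_t"
    and "\<theta>u = fps2_subst (theta c) var_u" and "\<theta>v = fps2_subst (theta c) (var_t + var_u)"
  define k where "k = (fps_const (fps_const c) :: 'a fps fps)"
  have add: "Sv = St * Cu + Ct * Su" "Cv = Ct * Cu + k * St * Su"
    unfolding St_def Su_def Sv_def Ct_def Cu_def Cv_def k_def by (fact fps_S_add fps_C_add)+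
  have \<theta>: "\<theta>t * St = var_t * Ct" "\<theta>u * Su = var_u * Cu" "\<theta>v * Sv = (var_t + var_u) * Cv"
    using arg_cong [OF theta_times_S [of c], of "\<lambda>f. fps2_subst f var_t"]
      arg_cong [OF theta_times_S [of c], of "\<lambda>f. fps2_subst f var_u"]
      arg_cong [OF theta_times_S [of c], of "\<lambda>f. fps2_subst f (var_t + var_u)"]
    unfolding \<theta>t_def \<theta>u_def \<theta>v_def St_def Su_def Sv_def Ct_def Cu_def Cv_def fps2_subst_simps
    by (simp_all add: fps2_subst_u)
  \<comment> \<open>The linear coefficient of \<open>fps_S c\<close> is 1, so t or u occurs with
    coefficient 1.\<close>
  have "fps2_subst (fps_S c) G \<noteq> 0" if "G = var_t \<or> G = var_u \<or> G = var_t + var_u" for G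
  proof
    assume 0: "fps2_subst (fps_S c) G = 0"
    then have "fps2_subst (fps_S c) G $ 0 $ 1 = 0" "fps2_subst (fps_S c) G $ 1 $ 0 = 0"
      by simp_all
    with that show False
      by (auto simp: fps2_subst_t_nth fps2_subst_u_nth fps2_subst_add_nth fps_S_def)
  qed
  then have nz: "St * Su * Sv \<noteq> 0"
    by (simp add: St_def Su_def Sv_def)
  have "St * Su * Sv * (var_u * \<theta>t * \<theta>v + var_t * \<theta>v * \<theta>u) =
      var_u * (\<theta>t * St) * (\<theta>v * Sv) * Su + var_t * (\<theta>v * Sv) * (\<theta>u * Su) * St"
    by (simp only: algebra_simps)
  also have "\<dots> = var_t * var_u * (var_t + var_u) * Cv * (St * Cu + Ct * Su)"
    unfolding \<theta> by (simp only: algebra_simps)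
  \<comment> \<open>One addition formula contracts the last factor to \<open>Sv\<close>, the other
    expands \<open>Cv\<close>.\<close>
  also have "\<dots> = var_t * var_u * (var_t + var_u) * (Ct * Cu + k * St * Su) * Sv"
    unfolding add by (simp only: mult_ac)
  also have "\<dots> = (var_t + var_u) * (\<theta>t * St) * (\<theta>u * Su) * Sv +
      var_t * var_u * (k * (var_t + var_u)) * (St * Su * Sv)"
    unfolding \<theta> by (simp only: algebra_simps)
  also have "\<dots> = St * Su * Sv * ((var_t + var_u) * \<theta>t * \<theta>u + var_t * var_u * (k * (var_t + var_u)))"
    by (simp only: algebra_simps)
  finally show ?thesis
    using nz unfolding func_eq_def fps2_subst_simps mult_cancel_left
    by (simp add: \<theta>t_def \<theta>u_def \<theta>v_def k_def)
qed

section \<open>The Riccati equation\<close>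

lemma theta_Riccati:
  fixes c :: "'a::field_char_0"
  shows "fps_X * fps_deriv (theta c) + (theta c - 1) * theta c = fps_X * (fps_const c * fps_X)"
  using func_eq_nth_1 [OF func_eq_theta, of c] by simp

text \<open>The difference d satisfies t d' + d (F + G - 1) = 0, where F + G - 1 has constant term
  1; at the lowest order n of d this reads (n + 1) d_n = 0.\<close>

lemma Riccati_unique:
  fixes F G :: "'a::field_char_0 fps"
  assumes "fps_X * fps_deriv F + (F - 1) * F = H" "fps_X * fps_deriv G + (G - 1) * G = H"
    and "F $ 0 = 1" "G $ 0 = 1"
  shows "F = G"
proof (rule ccontr)
  define d where "d = F - G"
  assume "F \<noteq> G"
  then have "d \<noteq> 0" by (simp add: d_def)
  define n where "n = subdegree d"
  have "fps_X * fps_deriv d + d * (F + G - 1) =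
      (fps_X * fps_deriv F + (F - 1) * F) - (fps_X * fps_deriv G + (G - 1) * G)"
    by (simp add: d_def algebra_simps)
  also have "\<dots> = 0"
    by (simp only: assms(1,2) diff_self)
  finally have "(fps_X * fps_deriv d) $ n + (d * (F + G - 1)) $ n = 0"
    by (simp only: fps_zero_nth flip: fps_add_nth)
  moreover have "(fps_X * fps_deriv d) $ n = of_nat n * d $ n"
    by (cases n) simp_all
  moreover have "(d * (F + G - 1)) $ n = d $ n"
  proof -
    have "subdegree (F + G - 1) = 0"
      using assms(3,4) by (intro subdegreeI) simp_all
    then show ?thesis
      using nth_subdegree_mult [of d "F + G - 1"] assms(3,4) by (simp add: n_def)
  qed
  ultimately have "of_nat n * d $ n + d $ n = 0"
    by (simp only:)
  then have "of_nat (Suc n) * d $ n = 0"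
    by (simp add: algebra_simps)
  with \<open>d \<noteq> 0\<close> show False
    by (simp add: n_def del: of_nat_Suc)
qed

lemma func_eq_self_imp_theta:
  fixes F R :: "'a::field_char_0 fps"
  assumes eq: "func_eq F F R" and F: "F $ 0 = 1" "F $ 1 = 0"
  obtains c where "F = theta c" "R = fps_const c * fps_X"
proof -
  have Ric: "fps_X * fps_deriv F + (F - 1) * F = fps_X * R"
    using func_eq_nth_1 [OF eq] F by simp
  have "fps_X * fps_deriv (fps_deriv F) + 2 * F * fps_deriv F =
      fps_deriv (fps_X * fps_deriv F + (F - 1) * F)"
    by (simp add: algebra_simps)
  also have "\<dots> = R + fps_X * fps_deriv R"
    unfolding Ric by simp
  \<comment> \<open>The equation of order two evaluates the same left side as 2 t R', so R + t R' =
    2 t R'.\<close>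
  finally have "fps_X * fps_deriv R = R"
    using func_eq_nth_2 [OF eq F] by (simp add: algebra_simps)
  then obtain c where R: "R = fps_const c * fps_X"
    using fps_X_deriv_eq_self by blast
  have "F = theta c"
    using Ric [unfolded R] theta_Riccati F(1) theta_nth_0 by (rule Riccati_unique)
  with R that show thesis by blast
qed

section \<open>Affine normalisation and classification of the solutions\<close>

text \<open>Merges the term with \<open>b * e\<close> and the term with R = c t from
  \<open>func_eq_affine_iff\<close> into the linear part of \<open>\<rho>\<close>.\<close>

lemma fps_const_X_split:
  fixes a b c d e :: "'a::field_char_0"
  shows "fps_const (b * e) * fps_X + fps_const (a * d) * (fps_const c * fps_X) =
    fps_const (a * d * c + b * e) * fps_X"
  by (simp add: algebra_simps flip: fps_const_add fps_const_mult)

lemma func_eq_imp_theta: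
  fixes \<phi> \<psi> \<rho> :: "'a::field_char_0 fps"
  assumes eq: "func_eq \<phi> \<psi> \<rho>" and nz: "\<psi> $ 0 * \<phi> $ 0 \<noteq> 0"
  obtains a b c d e where "\<phi> = fps_const a * theta c + fps_const b * fps_X"
    "\<psi> = fps_const d * theta c + fps_const e * fps_X"
    "\<rho> = fps_const (a * e + b * d) * theta c + fps_const (a * d * c + b * e) * fps_X"
    "a * d \<noteq> 0"
proof -
  define a b d e where "a = \<phi> $ 0" and "b = \<phi> $ 1" and "d = \<psi> $ 0" and "e = \<psi> $ 1"
  have ad: "a * d \<noteq> 0" "a \<noteq> 0" "d \<noteq> 0"
    using nz by (auto simp: a_def d_def)
  define h where "h = fps_const d * \<phi> - fps_const a * \<psi>"
  \<comment> \<open>Both sides equal \<open>fps_X * \<rho>\<close>, by the order-one equation and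
    its swapped version.\<close>
  have "fps_X * fps_const d * fps_deriv \<phi> + (\<psi> - fps_const d) * \<phi> =
      fps_X * fps_const a * fps_deriv \<psi> + (\<phi> - fps_const a) * \<psi>"
    using func_eq_nth_1 [OF eq] func_eq_nth_1 [OF func_eq_commute [OF eq]]
    by (simp only: a_def d_def)
  then have "fps_X * fps_deriv h = h"
    by (simp add: h_def algebra_simps)
  then have "h = fps_const (h $ 1) * fps_X"
    by (rule fps_X_deriv_eq_self)
  then have h: "fps_const d * \<phi> - fps_const a * \<psi> = fps_const (d * b - a * e) * fps_X"
    by (simp add: h_def b_def e_def)
  \<comment> \<open>Normalised so that \<open>F $ 0 = 1\<close> and
    \<open>F $ 1 = 0\<close>.\<close>
  define F where "F = fps_const (1 / a) * (\<phi> - fps_const b * fps_X)"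
  have \<phi>: "\<phi> = fps_const a * F + fps_const b * fps_X"
    using ad by (simp add: F_def flip: mult.assoc)
  have "fps_const a * \<psi> = fps_const a * (fps_const d * F + fps_const e * fps_X)"
    using h unfolding \<phi> by (simp add: algebra_simps flip: fps_const_mult fps_const_sub)
  then have \<psi>: "\<psi> = fps_const d * F + fps_const e * fps_X"
    using ad by simp
  \<comment> \<open>Obtained by solving the third argument in \<open>func_eq_affine_iff\<close> for
    R.\<close>
  define R where "R = fps_const (1 / (a * d)) *
    (\<rho> - fps_const (a * e + b * d) * F - fps_const (b * e) * fps_X)"
  have \<rho>: "\<rho> = fps_const (a * e + b * d) * F + fps_const (b * e) * fps_X + fps_const (a * d) * R"
    using ad by (simp add: R_def flip: mult.assoc)
  have "func_eq F F R"
    using eq unfolding func_eq_affine_iff [OF ad(1), of F b e R, symmetric]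
    by (simp only: flip: \<phi> \<psi> \<rho>)
  moreover have "F $ 0 = 1" "F $ 1 = 0"
    using ad by (simp_all add: F_def a_def b_def)
  ultimately obtain c where "F = theta c" "R = fps_const c * fps_X"
    by (rule func_eq_self_imp_theta)
  with \<phi> \<psi> \<rho> ad(1) show thesis
    by (intro that) (simp_all only: add.assoc fps_const_X_split)
qed

lemma func_eq_theta_affine:
  fixes a b c d e :: "'a::field_char_0"
  assumes "a * d \<noteq> 0"
  shows "func_eq (fps_const a * theta c + fps_const b * fps_X)
    (fps_const d * theta c + fps_const e * fps_X)
    (fps_const (a * e + b * d) * theta c + fps_const (a * d * c + b * e) * fps_X)"
  using func_eq_affine_iff [OF assms, of "theta c" b e "fps_const c * fps_X"] func_eq_theta [of c]
  by (simp only: add.assoc fps_const_X_split)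

lemma func_eq_iff_theta:
  fixes \<phi> \<psi> \<rho> :: "'a::field_char_0 fps"
  shows "func_eq \<phi> \<psi> \<rho> \<and> \<psi> $ 0 * \<phi> $ 0 \<noteq> 0 \<longleftrightarrow>
    (\<exists>a b c d e. \<phi> = fps_const a * theta c + fps_const b * fps_X \<and>
      \<psi> = fps_const d * theta c + fps_const e * fps_X \<and>
      \<rho> = fps_const (a * e + b * d) * theta c + fps_const (a * d * c + b * e) * fps_X \<and>
      a * d \<noteq> 0)" (is "?P \<longleftrightarrow> ?Q")
proof
  assume ?P
  then show ?Q
    by (blast elim: func_eq_imp_theta)
next
  assume ?Q
  then obtain a b c d e where *: "\<phi> = fps_const a * theta c + fps_const b * fps_X"
      "\<psi> = fps_const d * theta c + fps_const e * fps_X"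
      "\<rho> = fps_const (a * e + b * d) * theta c + fps_const (a * d * c + b * e) * fps_X"
      "a * d \<noteq> 0"
    by blast
  then have "\<psi> $ 0 * \<phi> $ 0 \<noteq> 0"
    by simp
  with func_eq_theta_affine [OF *(4)] show ?P
    unfolding *(1-3) by blast
qed

theorem theorem6p3:
  shows "{(\<phi>, \<psi>, \<rho>) :: 'a::field_char_0 fps \<times> 'a fps \<times> 'a fps | \<phi> \<psi> \<rho>.
            fps2_subst \<phi> var_t
                * fps2_quot (fps2_subst \<psi> (var_t + var_u) - fps2_subst \<psi> var_u) var_t
              + fps2_quot (fps2_subst \<phi> (var_t + var_u) - fps2_subst \<phi> var_t) var_u
                * fps2_subst \<psi> var_u
              = fps2_subst \<rho> (var_t + var_u)
            \<and> \<psi> $ 0 * \<phi> $ 0 \<noteq> 0} =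
         {(fps_const a * theta c + fps_const b * fps_X,
           fps_const d * theta c + fps_const e * fps_X,
           fps_const (a * e + b * d) * theta c + fps_const (a * d * c + b * e) * fps_X)
          | a b c d e. a * d \<noteq> 0}"
  unfolding func_eq_iff_quot func_eq_iff_theta by blast

end
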